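(* Let $c_2\ge c_1>0$ and let $\Gamma_1,\Gamma_2>0$ satisfy $\Gamma_1\le\frac{c_1}{2c_2^2}$ and $\Gamma_2\ge\frac1{c_1}$. Let $x_c\in\mathbb{R}^n$ be a point with $\theta(x_c)<-\sigma_k$ for which the search direction $v_D(x_c)$ is a Newton-type direction, i.e. $$v_D(x_c)=v_N(x_c)=\operatorname{argmin}_{d\in\mathbb{R}^n}\max_{j=1,\ldots,m}\nabla f_j(x_c)^\top d+\frac12d^\top B_j(x_c)d,$$ where the symmetric positive definite matrices $B_j(x_c)$ satisfy, for all $j=1,\ldots,m$, $$c_1\le\lambda_{\min}(B_j(x_c))\le\lambda_{\max}(B_j(x_c))\le c_2.$$ Then $v_D(x_c)=v_N(x_c)$ always passes the tests of the Front Descent algorithm, that is, $$\mathcal{D}(x_c,v_N(x_c))\le-\Gamma_1\|v(x_c)\|^2\quad\text{and}\quad\|v_N(x_c)\|\le\Gamma_2\|v(x_c)\|.$$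
   Context: $F=(f_1,\ldots,f_m)^\top:\mathbb{R}^n\to\mathbb{R}^m$ is continuously differentiable. $\mathcal{D}(x,d)=\max_{j=1,\ldots,m}\nabla f_j(x)^\top d$. $\theta(x)=\min_{d\in\mathbb{R}^n}\max_{j=1,\ldots,m}\nabla f_j(x)^\top d+\frac12\|d\|^2$, and $v(x)$ is the unique minimizer (the steepest common descent direction). $\lambda_{\min},\lambda_{\max}$ denote minimum and maximum eigenvalues. In the Front Descent algorithm, with parameters $\Gamma_1,\Gamma_2>0$ and thresholds $\sigma_k\ge0$, at iteration $k$ a tentative direction $v_D(x_c)$ is computed at each processed point $x_c$ with $\theta(x_c)<-\sigma_k$, and it is used as search direction if and only if the two displayed inequalities (the "tests") hold; otherwise $v(x_c)$ is used. *)

theory Defs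
  imports "HOL-Analysis.Analysis"
begin

definition continuously_differentiable :: "(real^'n \<Rightarrow> real^'m) \<Rightarrow> bool" where
  "continuously_differentiable F \<longleftrightarrow>
     F differentiable_on UNIV \<and> continuous_on UNIV (\<lambda>x. jacobian F (at x))"

definition grad :: "('a::real_inner \<Rightarrow> real) \<Rightarrow> 'a \<Rightarrow> 'a" where
  "grad f x = (THE g. GDERIV f x :> g)"

text \<open>A map \<open>F = (f\<^sub>1, \<dots>, f\<^sub>m)\<close> has type \<open>real^'n \<Rightarrow> real^'m\<close>, its \<open>j\<close>-th component
  being \<open>\<lambda>y. F y $ j\<close>; the index type \<open>'m\<close> is finite and nonempty.\<close>

definition max_dir_deriv :: "(real^'n \<Rightarrow> real^'m) \<Rightarrow> real^'n \<Rightarrow> real^'n \<Rightarrow> real" where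
  "max_dir_deriv F x d = (MAX j. grad (\<lambda>y. F y $ j) x \<bullet> d)"

definition theta :: "(real^'n \<Rightarrow> real^'m) \<Rightarrow> real^'n \<Rightarrow> real" where
  "theta F x = (INF d. max_dir_deriv F x d + 1/2 * (norm d)\<^sup>2)"

definition steepest_direction :: "(real^'n \<Rightarrow> real^'m) \<Rightarrow> real^'n \<Rightarrow> real^'n" where
  "steepest_direction F x = (ARG_MIN (\<lambda>d. max_dir_deriv F x d + 1/2 * (norm d)\<^sup>2) d. True)"

definition newton_direction ::
    "(real^'n \<Rightarrow> real^'m) \<Rightarrow> ('m \<Rightarrow> real^'n \<Rightarrow> real^'n^'n) \<Rightarrow> real^'n \<Rightarrow> real^'n" where
  "newton_direction F B x =
     (ARG_MIN (\<lambda>d. MAX j. grad (\<lambda>y. F y $ j) x \<bullet> d + 1/2 * (d \<bullet> (B j x *v d))) d. True)"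

definition symmetric_positive_definite :: "real^'n^'n \<Rightarrow> bool" where
  "symmetric_positive_definite A \<longleftrightarrow> transpose A = A \<and> (\<forall>d. d \<noteq> 0 \<longrightarrow> 0 < d \<bullet> (A *v d))"

text \<open>Real eigenvalues. For a symmetric matrix this is the whole spectrum, which is finite and
  nonempty, so that \<^const>\<open>Min\<close> and \<^const>\<open>Max\<close> below are then meaningful.\<close>

definition eigenvalues :: "real^'n^'n \<Rightarrow> real set" where
  "eigenvalues A = {l. \<exists>v. v \<noteq> 0 \<and> A *v v = l *\<^sub>R v}"

definition lambda_min :: "real^'n^'n \<Rightarrow> real" where
  "lambda_min A = Min (eigenvalues A)"

definition lambda_max :: "real^'n^'n \<Rightarrow> real" where
  "lambda_max A = Max (eigenvalues A)"

text \<open>The infimum in \<^const>\<open>theta\<close> is attained, and at exactly one point.\<close>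

lemma max_dir_deriv_le_iff:
  "max_dir_deriv F x d \<le> c \<longleftrightarrow> (\<forall>j. grad (\<lambda>y. F y $ j) x \<bullet> d \<le> c)"
  unfolding max_dir_deriv_def by (subst Max_le_iff) auto

lemma max_dir_deriv_ge: "grad (\<lambda>y. F y $ j) x \<bullet> d \<le> max_dir_deriv F x d"
  using max_dir_deriv_le_iff by blast

lemma continuous_on_max_dir_deriv: "continuous_on S (max_dir_deriv F x)"
proof -
  define K where "K = (\<Sum>j\<in>UNIV. norm (grad (\<lambda>y. F y $ j) x))"
  have K: "norm (grad (\<lambda>y. F y $ j) x) \<le> K" for j
    unfolding K_def by (rule member_le_sum) auto
  have *: "max_dir_deriv F x a - max_dir_deriv F x b \<le> K * norm (a - b)" for a b
  proof -
    have "grad (\<lambda>y. F y $ j) x \<bullet> a \<le> max_dir_deriv F x b + K * norm (a - b)" for j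
    proof -
      have "grad (\<lambda>y. F y $ j) x \<bullet> (a - b) \<le> K * norm (a - b)"
        by (rule order_trans[OF norm_cauchy_schwarz mult_right_mono[OF K]]) simp
      with max_dir_deriv_ge[of F j x b] show ?thesis by (simp add: inner_diff_right)
    qed
    then have "max_dir_deriv F x a \<le> max_dir_deriv F x b + K * norm (a - b)"
      by (simp add: max_dir_deriv_le_iff)
    then show ?thesis by simp
  qed
  have K0: "0 \<le> K" unfolding K_def by (rule sum_nonneg) simp
  have "K-lipschitz_on S (max_dir_deriv F x)"
  proof (rule lipschitz_onI[OF _ K0])
    fix a b
    show "dist (max_dir_deriv F x a) (max_dir_deriv F x b) \<le> K * dist a b"
      using *[of a b] *[of b a] by (simp add: dist_norm norm_minus_commute abs_le_iff)
  qed
  then show ?thesis by (rule lipschitz_on_continuous_on)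
qed

lemma steepest_ex1:
  "\<exists>!d. is_arg_min (\<lambda>d. max_dir_deriv F x d + 1/2 * (norm d)\<^sup>2) (\<lambda>_. True) d"
proof -
  let ?p = "\<lambda>d. max_dir_deriv F x d + 1/2 * (norm d)\<^sup>2"
  fix j0
  define M where "M = norm (grad (\<lambda>y. F y $ j0) x)"
  have p0: "?p 0 = 0" by (simp add: max_dir_deriv_def)
  have "\<exists>d\<in>cball 0 (2*M). \<forall>e\<in>cball 0 (2*M). ?p d \<le> ?p e"
    by (rule continuous_attains_inf)
       (auto intro!: continuous_intros continuous_on_max_dir_deriv simp: M_def)
  then obtain d where d: "\<And>e. norm e \<le> 2*M \<Longrightarrow> ?p d \<le> ?p e"
    unfolding Ball_def mem_cball_0 by blast
  have min: "?p d \<le> ?p e" for e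
  proof (cases "norm e \<le> 2*M")
    case False
    have "- (M * norm e) \<le> max_dir_deriv F x e"
      using Cauchy_Schwarz_ineq2[of "grad (\<lambda>y. F y $ j0) x" e] max_dir_deriv_ge[of F j0 x e]
      unfolding M_def by linarith
    moreover have "2*M * norm e \<le> norm e * norm e" using False by (intro mult_right_mono) auto
    ultimately have "0 \<le> ?p e" by (simp add: power2_eq_square)
    moreover have "?p d \<le> ?p 0" by (rule d) (simp add: M_def)
    ultimately show ?thesis using p0 by linarith
  qed (rule d)
  have uniq: "a = b" if a: "\<And>e. ?p a \<le> ?p e" and b: "\<And>e. ?p b \<le> ?p e" for a b
  proof -
    let ?m = "(1/2) *\<^sub>R (a + b)"
    have "max_dir_deriv F x ?m \<le> (max_dir_deriv F x a + max_dir_deriv F x b) / 2"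
    proof -
      have "grad (\<lambda>y. F y $ j) x \<bullet> ?m \<le> (max_dir_deriv F x a + max_dir_deriv F x b) / 2" for j
        using max_dir_deriv_ge[of F j x a] max_dir_deriv_ge[of F j x b]
        by (simp add: inner_add_right)
      then show ?thesis unfolding max_dir_deriv_le_iff by blast
    qed
    moreover have "(norm ?m)\<^sup>2 = ((norm a)\<^sup>2 + (norm b)\<^sup>2) / 2 - (norm (a - b))\<^sup>2 / 4"
      by (simp add: power2_norm_eq_inner inner_simps inner_commute field_simps)
    moreover have "C \<le> 0"
      if "m \<le> (p + q) / 2" "n = (A + B) / 2 - C / 4"
         "p + 1/2 * A \<le> m + 1/2 * n" "q + 1/2 * B \<le> m + 1/2 * n" for m n p q A B C :: real
      using that by argo
    ultimately have "(norm (a - b))\<^sup>2 \<le> 0" using a[of ?m] b[of ?m] by blast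
    then show ?thesis by simp
  qed
  show ?thesis
    using min uniq by (auto simp: is_arg_min_linorder)
qed

lemma theta_eq_min:
  "theta F x = max_dir_deriv F x (steepest_direction F x) + 1/2 * (norm (steepest_direction F x))\<^sup>2"
proof -
  let ?p = "\<lambda>d. max_dir_deriv F x d + 1/2 * (norm d)\<^sup>2"
  have "is_arg_min ?p (\<lambda>_. True) (steepest_direction F x)"
    unfolding steepest_direction_def arg_min_def
    using someI_ex[OF ex1_implies_ex[OF steepest_ex1]] .
  then have m: "?p (steepest_direction F x) \<le> ?p e" for e
    by (simp add: is_arg_min_linorder)
  show ?thesis
    unfolding theta_def by (rule cInf_eq_minimum) (use m in auto)
qed

end

theory Submission
  imports Defs
begin

text \<open>Write \<open>v\<close> for the steepest direction, \<open>w\<close> for the Newton direction, \<open>D = max_dir_deriv F x\<close> and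
  \<open>q\<close> for the objective that \<open>w\<close> minimizes. Minimality of \<open>q\<close> along the segment from \<open>0\<close> to \<open>w\<close>, together
  with the strong convexity of \<open>q\<close>, gives \<open>D w \<le> - c\<^sub>1 \<parallel>w\<parallel>\<^sup>2\<close>; the same argument for the identity
  matrices gives \<open>D v \<le> - \<parallel>v\<parallel>\<^sup>2\<close>. The first-order condition at \<open>v\<close> is \<open>- v \<bullet> d \<le> D d\<close> for all \<open>d\<close>, and
  \<open>d = w\<close> yields \<open>c\<^sub>1 \<parallel>w\<parallel> \<le> \<parallel>v\<parallel>\<close>. Comparing \<open>w\<close> with \<open>v / c\<^sub>2\<close> yields
  \<open>D w \<le> q w \<le> q (v / c\<^sub>2) \<le> - \<parallel>v\<parallel>\<^sup>2 / (2 c\<^sub>2)\<close>, which is stronger than the first test because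
  \<open>c\<^sub>1 / (2 c\<^sub>2\<^sup>2) \<le> 1 / (2 c\<^sub>2)\<close>. Bounding the quadratic forms by the extreme eigenvalues rests on the
  fact that the extrema of the Rayleigh quotient are eigenvalues.\<close>

section \<open>Extreme eigenvalues and quadratic forms of symmetric matrices\<close>

lemma inner_symmetric_matrix:
  fixes A :: "real^'n^'n"
  assumes "transpose A = A"
  shows "x \<bullet> (A *v y) = (A *v x) \<bullet> y"
  by (metis assms dot_lmul_matrix transpose_matrix_vector)

text \<open>Eigenvectors for distinct eigenvalues are orthogonal, hence independent. Finiteness is
  what gives \<open>Min\<close> and \<open>Max\<close> of the spectrum their usual bounds.\<close>

lemma finite_eigenvalues_symmetric:
  fixes A :: "real^'n^'n"
  assumes sym: "transpose A = A"
  shows "finite (eigenvalues A)"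
proof -
  have "\<forall>l\<in>eigenvalues A. \<exists>v. v \<noteq> 0 \<and> A *v v = l *\<^sub>R v"
    by (simp add: eigenvalues_def)
  then obtain f where f: "\<And>l. l \<in> eigenvalues A \<Longrightarrow> f l \<noteq> 0 \<and> A *v f l = l *\<^sub>R f l"
    by metis
  have orth: "f k \<bullet> f l = 0" if "k \<in> eigenvalues A" "l \<in> eigenvalues A" "k \<noteq> l" for k l
    using inner_symmetric_matrix[OF sym, of "f k" "f l"] f[OF that(1)] f[OF that(2)] that(3)
    by auto
  have inj: "inj_on f (eigenvalues A)"
    by (rule inj_onI) (metis f orth inner_eq_zero_iff)
  have "independent (f ` eigenvalues A)"
    by (rule pairwise_orthogonal_independent)
      (use f orth in \<open>auto simp: pairwise_def orthogonal_def\<close>)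
  then show ?thesis
    using inj finite_imageD independent_imp_finite by blast
qed

text \<open>The form is minimal at \<open>u\<close>, yet a small step from \<open>u\<close> along
  \<open>- (S *v u)\<close> would make it negative if \<open>S *v u\<close> were nonzero: the linear
  term of the expansion dominates the quadratic one.\<close>

lemma psd_kernel:
  fixes S :: "real^'n^'n"
  assumes sym: "transpose S = S"
    and psd: "\<And>d. 0 \<le> d \<bullet> (S *v d)"
    and u: "u \<bullet> (S *v u) = 0"
  shows "S *v u = 0"
proof (rule ccontr)
  assume nz: "S *v u \<noteq> 0"
  define e where "e = S *v u"
  define N where "N = e \<bullet> e"
  define K where "K = e \<bullet> (S *v e)"
  have N: "0 < N" using nz by (simp add: N_def e_def)
  have K: "0 \<le> K" unfolding K_def by (rule psd)
  have ineq: "0 \<le> t * t * K - 2 * t * N" for t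
  proof -
    have ue: "u \<bullet> (S *v e) = N"
      by (simp add: inner_symmetric_matrix[OF sym] e_def N_def)
    have eu: "e \<bullet> (S *v u) = N" by (simp add: N_def e_def)
    have "(u - t *\<^sub>R e) \<bullet> (S *v (u - t *\<^sub>R e)) = t * t * K - 2 * t * N"
      by (simp add: matrix_vector_mult_diff_distrib scaleR_matrix_vector_assoc[symmetric] matrix_vector_mult_scaleR
            inner_diff_left inner_diff_right u ue eu K_def[symmetric] algebra_simps)
    then show ?thesis using psd by metis
  qed
  have "t * (2 * N) \<le> t * (t * K)" for t using ineq[of t] by (simp add: algebra_simps)
  \<comment> \<open>The step length is \<open>t = N / (K + 1)\<close>: it is positive even when
    \<open>K = 0\<close>, and \<open>t * K\<close> stays at most \<open>N\<close>.\<close>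
  then have "2 * N \<le> N / (K + 1) * K"
    by (rule mult_left_le_imp_le) (use N K in simp)
  also have "\<dots> \<le> N" using N K by (simp add: field_simps)
  finally show False using N by simp
qed

text \<open>Let \<open>u\<close> minimize the form on the compact unit sphere, with value
  \<open>l\<close>. Then \<open>A - l I\<close> is positive semidefinite and its form vanishes at
  \<open>u\<close>, so \<open>psd_kernel\<close> makes \<open>u\<close> an eigenvector.\<close>

lemma rayleigh_min_eigenvalue:
  fixes A :: "real^'n^'n"
  assumes sym: "transpose A = A"
  obtains l where "l \<in> eigenvalues A" "\<And>d. l * (d \<bullet> d) \<le> d \<bullet> (A *v d)"
proof -
  have "\<exists>u\<in>sphere 0 1. \<forall>d\<in>sphere 0 1. u \<bullet> (A *v u) \<le> d \<bullet> (A *v d)"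
    by (rule continuous_attains_inf)
      (auto intro!: continuous_intros matrix_vector_mult_linear_continuous_on)
  then obtain u where u: "norm u = 1" and min: "\<And>d. norm d = 1 \<Longrightarrow> u \<bullet> (A *v u) \<le> d \<bullet> (A *v d)"
    by auto
  define l where "l = u \<bullet> (A *v u)"
  have bound: "l * (d \<bullet> d) \<le> d \<bullet> (A *v d)" for d
  proof (cases "d = 0")
    case False
    have "l \<le> (d /\<^sub>R norm d) \<bullet> (A *v (d /\<^sub>R norm d))"
      unfolding l_def by (rule min) (simp add: False)
    also have "\<dots> = (d \<bullet> (A *v d)) / (d \<bullet> d)"
      by (simp add: matrix_vector_mult_scaleR dot_square_norm power2_eq_square field_simps)
    finally show ?thesis using False by (simp add: pos_le_divide_eq)
  qed simp
  define S where "S = A - l *\<^sub>R mat 1"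
  have S: "S *v d = A *v d - l *\<^sub>R d" for d
    by (simp add: S_def matrix_vector_mult_diff_rdistrib scaleR_matrix_vector_assoc[symmetric])
  have "transpose S = S"
    using sym by (simp add: S_def transpose_def mat_def vec_eq_iff eq_commute)
  then have "S *v u = 0"
    by (rule psd_kernel)
      (use bound u in \<open>auto simp: S inner_diff_right l_def dot_square_norm\<close>)
  moreover have "u \<noteq> 0" using u by auto
  ultimately have "l \<in> eigenvalues A"
    by (auto simp: S eigenvalues_def)
  then show thesis using that bound by blast
qed

lemma lambda_min_le_form:
  fixes A :: "real^'n^'n"
  assumes "transpose A = A"
  shows "lambda_min A * (d \<bullet> d) \<le> d \<bullet> (A *v d)"
proof -
  obtain l where l: "l \<in> eigenvalues A" "\<And>d. l * (d \<bullet> d) \<le> d \<bullet> (A *v d)"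
    using rayleigh_min_eigenvalue[OF assms] by blast
  have "lambda_min A \<le> l"
    unfolding lambda_min_def by (rule Min_le[OF finite_eigenvalues_symmetric[OF assms] l(1)])
  then have "lambda_min A * (d \<bullet> d) \<le> l * (d \<bullet> d)" by (rule mult_right_mono) simp
  with l(2)[of d] show ?thesis by linarith
qed

text \<open>Apply the Rayleigh minimum to \<open>- A\<close>, whose eigenvalues are the negatives of
  those of \<open>A\<close>.\<close>

lemma form_le_lambda_max:
  fixes A :: "real^'n^'n"
  assumes "transpose A = A"
  shows "d \<bullet> (A *v d) \<le> lambda_max A * (d \<bullet> d)"
proof -
  have neg: "(- A) *v x = - (A *v x)" for x
    using matrix_vector_mult_diff_rdistrib[of 0 A x] by simp
  have "transpose (- A) = - A"
    using assms by (simp add: transpose_def vec_eq_iff)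
  then obtain l where l: "l \<in> eigenvalues (- A)" "\<And>d. l * (d \<bullet> d) \<le> d \<bullet> (- A *v d)"
    using rayleigh_min_eigenvalue by blast
  have "- l \<in> eigenvalues A"
    using l(1) by (auto simp: eigenvalues_def neg) (metis minus_minus)
  then have "- l \<le> lambda_max A"
    unfolding lambda_max_def by (rule Max_ge[OF finite_eigenvalues_symmetric[OF assms]])
  then have "- l * (d \<bullet> d) \<le> lambda_max A * (d \<bullet> d)" by (rule mult_right_mono) simp
  with l(2)[of d] show ?thesis by (simp add: neg)
qed

section \<open>Minimizers of a finite maximum of linear plus quadratic-like functions\<close>

lemma MAX_le_iff:
  fixes f :: "'m::finite \<Rightarrow> real"
  shows "(MAX j. f j) \<le> c \<longleftrightarrow> (\<forall>j. f j \<le> c)"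
  by (subst Max_le_iff) auto

lemma MAX_ge:
  fixes f :: "'m::finite \<Rightarrow> real"
  shows "f j \<le> (MAX j. f j)"
  using MAX_le_iff by blast

lemma continuous_on_MAX:
  fixes f :: "'m::finite \<Rightarrow> 'a::topological_space \<Rightarrow> real"
  assumes "\<And>j. continuous_on S (f j)"
  shows "continuous_on S (\<lambda>x. MAX j. f j x)"
proof -
  have "continuous_on S (\<lambda>x. Max ((\<lambda>j. f j x) ` J))" if "finite J" "J \<noteq> {}" for J
    using that
  proof (induction J rule: finite_ne_induct)
    case (insert j J)
    then show ?case by (simp add: continuous_on_max assms)
  qed (simp add: assms)
  then show ?thesis by simp
qed

text \<open>Coercivity: outside a ball the objective is nonnegative, while it is 0 at the origin. A
  minimizer over the ball is therefore global.\<close>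

lemma MAX_quadratic_minimizer_exists:
  fixes g :: "'m::finite \<Rightarrow> 'a::euclidean_space" and b :: "'m \<Rightarrow> 'a \<Rightarrow> real"
  assumes c: "0 < c"
    and lb: "\<And>j d. c * (norm d)\<^sup>2 \<le> b j d"
    and zero: "\<And>j. b j 0 = 0"
    and cont: "\<And>j. continuous_on UNIV (b j)"
  obtains w where "\<And>d. (MAX j. g j \<bullet> w + 1/2 * b j w) \<le> (MAX j. g j \<bullet> d + 1/2 * b j d)"
proof -
  let ?q = "\<lambda>d. MAX j. g j \<bullet> d + 1/2 * b j d"
  fix j0
  \<comment> \<open>Beyond this radius \<open>c/2 * (norm d)^2\<close> outweighs the Cauchy-Schwarz
    bound \<open>norm (g j0) * norm d\<close>. A single index suffices, as the maximum dominates
    each component.\<close>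
  define R where "R = 2 * norm (g j0) / c"
  have R: "0 \<le> R" using c by (simp add: R_def)
  have "continuous_on (cball 0 R) ?q"
    by (intro continuous_on_MAX continuous_intros continuous_on_subset[OF cont]) simp
  then have "\<exists>w\<in>cball 0 R. \<forall>d\<in>cball 0 R. ?q w \<le> ?q d"
    by (intro continuous_attains_inf) (use R in auto)
  then obtain w where w: "\<And>d. norm d \<le> R \<Longrightarrow> ?q w \<le> ?q d"
    unfolding Ball_def mem_cball_0 by blast
  have "?q w \<le> ?q d" for d
  proof (cases "norm d \<le> R")
    case False
    then have "2 * norm (g j0) \<le> c * norm d"
      using c by (simp add: R_def field_simps)
    then have "2 * norm (g j0) * norm d \<le> c * norm d * norm d"
      by (rule mult_right_mono) simp
    then have "0 \<le> - (norm (g j0) * norm d) + 1/2 * (c * (norm d)\<^sup>2)"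
      by (simp add: power2_eq_square)
    also have "\<dots> \<le> g j0 \<bullet> d + 1/2 * b j0 d"
      using Cauchy_Schwarz_ineq2[of "g j0" d] lb[of d j0] by argo
    also have "\<dots> \<le> ?q d" by (rule MAX_ge)
    finally have "0 \<le> ?q d" .
    moreover have "?q w \<le> ?q 0" by (rule w) (simp add: R)
    moreover have "?q 0 = 0" by (simp add: zero)
    ultimately show ?thesis by linarith
  qed (rule w)
  then show thesis by (rule that)
qed

text \<open>Compare \<open>w\<close> with \<open>t w\<close> for \<open>0 < t < 1\<close>, divide by
  \<open>1 - t\<close> and let t tend to 1. Keeping \<open>b\<close> abstract covers both the Newton
  forms and the squared norm.\<close>

lemma MAX_quadratic_minimizer_descent:
  fixes g :: "'m::finite \<Rightarrow> 'a::real_inner" and b :: "'m \<Rightarrow> 'a \<Rightarrow> real"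
  assumes lb: "\<And>j. c * (norm w)\<^sup>2 \<le> b j w"
    and hom: "\<And>j t. b j (t *\<^sub>R w) = t\<^sup>2 * b j w"
    and min: "\<And>d. (MAX j. g j \<bullet> w + 1/2 * b j w) \<le> (MAX j. g j \<bullet> d + 1/2 * b j d)"
  shows "g j \<bullet> w \<le> - c * (norm w)\<^sup>2"
proof -
  define Q where "Q = (MAX j. g j \<bullet> w + 1/2 * b j w)"
  have Q: "g i \<bullet> w + 1/2 * b i w \<le> Q" for i
    unfolding Q_def by (rule MAX_ge)
  have scaled: "Q \<le> - (c * (norm w)\<^sup>2) / 2 * t" if t: "0 < t" "t < 1" for t :: real
  proof -
    have "g i \<bullet> (t *\<^sub>R w) + 1/2 * b i (t *\<^sub>R w)
        \<le> t * Q - t * (1 - t) / 2 * (c * (norm w)\<^sup>2)" for i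
    proof -
      have "t * (g i \<bullet> w + 1/2 * b i w) \<le> t * Q"
        using Q t by (intro mult_left_mono) auto
      moreover have "t * (1 - t) / 2 * (c * (norm w)\<^sup>2) \<le> t * (1 - t) / 2 * b i w"
        using lb t by (intro mult_left_mono) auto
      moreover have "g i \<bullet> (t *\<^sub>R w) + 1/2 * b i (t *\<^sub>R w)
          = t * (g i \<bullet> w + 1/2 * b i w) - t * (1 - t) / 2 * b i w"
        by (simp add: hom power2_eq_square field_simps)
      ultimately show ?thesis by linarith
    qed
    then have "(MAX j. g j \<bullet> (t *\<^sub>R w) + 1/2 * b j (t *\<^sub>R w))
        \<le> t * Q - t * (1 - t) / 2 * (c * (norm w)\<^sup>2)"
      unfolding MAX_le_iff by blast
    with min[of "t *\<^sub>R w"] have "Q \<le> t * Q - t * (1 - t) / 2 * (c * (norm w)\<^sup>2)"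
      unfolding Q_def by linarith
    then have "(1 - t) * Q \<le> (1 - t) * (- (c * (norm w)\<^sup>2) / 2 * t)"
      by (simp add: field_simps)
    then show ?thesis by (rule mult_left_le_imp_le) (use t in simp)
  qed
  have "((\<lambda>t. - (c * (norm w)\<^sup>2) / 2 * t) \<longlongrightarrow> - (c * (norm w)\<^sup>2) / 2 * 1) (at_left 1)"
    by (intro tendsto_intros)
  moreover have "\<forall>\<^sub>F t in at_left 1. Q \<le> - (c * (norm w)\<^sup>2) / 2 * t"
    unfolding eventually_at_left_field by (rule exI[of _ 0]) (use scaled in auto)
  ultimately have "Q \<le> - (c * (norm w)\<^sup>2) / 2 * 1"
    by (intro tendsto_lowerbound) auto
  \<comment> \<open>The limit gives only half of the decrease; removing \<open>1/2 * b j w\<close>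
    from the j-th term of \<open>Q\<close> supplies the other half.\<close>
  with Q[of j] lb[of j] show ?thesis by simp
qed

section \<open>Optimality properties of the Newton and steepest directions\<close>

lemma newton_direction_minimal:
  assumes "0 < c" "\<And>j d. c * (norm d)\<^sup>2 \<le> d \<bullet> (B j x *v d)"
  shows "(MAX j. grad (\<lambda>y. F y $ j) x \<bullet> newton_direction F B x
            + 1/2 * (newton_direction F B x \<bullet> (B j x *v newton_direction F B x)))
      \<le> (MAX j. grad (\<lambda>y. F y $ j) x \<bullet> d + 1/2 * (d \<bullet> (B j x *v d)))"
    (is "?q (newton_direction F B x) \<le> ?q d")
proof -
  obtain w where "\<And>d. ?q w \<le> ?q d"
    by (rule MAX_quadratic_minimizer_exists
          [where g = "\<lambda>j. grad (\<lambda>y. F y $ j) x" and b = "\<lambda>j d. d \<bullet> (B j x *v d)", OF assms])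
      (auto intro!: continuous_intros matrix_vector_mult_linear_continuous_on)
  then have "is_arg_min ?q (\<lambda>_. True) w"
    by (simp add: is_arg_min_linorder)
  \<comment> \<open>\<open>ARG_MIN\<close> is a Hilbert choice, so it is a minimizer once some
    minimizer \<open>w\<close> is known to exist.\<close>
  then have "is_arg_min ?q (\<lambda>_. True) (newton_direction F B x)"
    unfolding newton_direction_def arg_min_def by (rule someI)
  then show ?thesis by (simp add: is_arg_min_linorder)
qed

lemma steepest_direction_minimal:
  "max_dir_deriv F x (steepest_direction F x) + 1/2 * (norm (steepest_direction F x))\<^sup>2
     \<le> max_dir_deriv F x d + 1/2 * (norm d)\<^sup>2"
proof -
  have "is_arg_min (\<lambda>d. max_dir_deriv F x d + 1/2 * (norm d)\<^sup>2) (\<lambda>_. True) (steepest_direction F x)"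
    unfolding steepest_direction_def arg_min_def
    using someI_ex[OF ex1_implies_ex[OF steepest_ex1]] .
  then show ?thesis by (simp add: is_arg_min_linorder)
qed

lemma max_dir_deriv_steepest_le:
  "max_dir_deriv F x (steepest_direction F x) \<le> - (norm (steepest_direction F x))\<^sup>2"
proof -
  \<comment> \<open>The quadratic term is the same for all j and moves into the maximum, which gives
    the shape of the descent lemma with \<open>c = 1\<close>.\<close>
  have MAX: "(MAX j. grad (\<lambda>y. F y $ j) x \<bullet> d + 1/2 * (norm d)\<^sup>2)
      = max_dir_deriv F x d + 1/2 * (norm d)\<^sup>2" for d
    unfolding max_dir_deriv_def by (rule Max_add_commute) auto
  have "grad (\<lambda>y. F y $ j) x \<bullet> steepest_direction F x \<le> - 1 * (norm (steepest_direction F x))\<^sup>2" for j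
    by (rule MAX_quadratic_minimizer_descent[where b = "\<lambda>_ d. (norm d)\<^sup>2"])
      (simp_all only: MAX steepest_direction_minimal, simp_all add: power_mult_distrib)
  then show ?thesis by (simp add: max_dir_deriv_le_iff)
qed

text \<open>Perturb the minimizer \<open>v\<close> to \<open>v + t d\<close>, use sublinearity of
  \<open>D\<close>, divide by \<open>t\<close> and let t tend to 0 from the right. Geometrically,
  \<open>- v\<close> lies in the convex hull of the gradients, whose support function is
  \<open>D\<close>.\<close>

lemma max_dir_deriv_ge_steepest:
  "- (steepest_direction F x \<bullet> d) \<le> max_dir_deriv F x d"
proof -
  define v where "v = steepest_direction F x"
  define D where "D = max_dir_deriv F x"
  have perturbed: "- (v \<bullet> d) - (norm d)\<^sup>2 / 2 * t \<le> D d" if t: "0 < t" for t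
  proof -
    have "D (v + t *\<^sub>R d) \<le> D v + t * D d"
    proof -
      have "grad (\<lambda>y. F y $ j) x \<bullet> (v + t *\<^sub>R d) \<le> D v + t * D d" for j
        unfolding D_def inner_add_right inner_scaleR_right
        by (intro add_mono mult_left_mono max_dir_deriv_ge) (use t in simp)
      then show ?thesis unfolding D_def max_dir_deriv_le_iff by blast
    qed
    moreover have "(norm (v + t *\<^sub>R d))\<^sup>2 = (norm v)\<^sup>2 + 2 * (t * (v \<bullet> d)) + t * t * (norm d)\<^sup>2"
      by (simp add: power2_norm_eq_inner inner_simps inner_commute algebra_simps)
    moreover have "D v + 1/2 * (norm v)\<^sup>2 \<le> D (v + t *\<^sub>R d) + 1/2 * (norm (v + t *\<^sub>R d))\<^sup>2"
      unfolding D_def v_def by (rule steepest_direction_minimal)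
    ultimately have "0 \<le> t * D d + t * (v \<bullet> d) + 1/2 * (t * t * (norm d)\<^sup>2)"
      by argo
    then have "0 \<le> t * (D d + v \<bullet> d + (norm d)\<^sup>2 / 2 * t)"
      by (simp add: algebra_simps)
    with t have "0 \<le> D d + v \<bullet> d + (norm d)\<^sup>2 / 2 * t"
      by (simp add: zero_le_mult_iff)
    then show ?thesis by linarith
  qed
  have "((\<lambda>t. - (v \<bullet> d) - (norm d)\<^sup>2 / 2 * t) \<longlongrightarrow> - (v \<bullet> d) - (norm d)\<^sup>2 / 2 * 0) (at_right 0)"
    by (intro tendsto_intros)
  moreover have "\<forall>\<^sub>F t in at_right 0. - (v \<bullet> d) - (norm d)\<^sup>2 / 2 * t \<le> D d"
    unfolding eventually_at_right_field by (rule exI[of _ 1]) (use perturbed in auto)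
  ultimately have "- (v \<bullet> d) - (norm d)\<^sup>2 / 2 * 0 \<le> D d"
    by (intro tendsto_upperbound) auto
  then show ?thesis by (simp add: v_def D_def)
qed

section \<open>The two tests for the Newton direction\<close>

theorem proposition5p8:
  fixes F :: "real^'n \<Rightarrow> real^'m"
    and B :: "'m \<Rightarrow> real^'n \<Rightarrow> real^'n^'n"
    and v\<^sub>D :: "real^'n \<Rightarrow> real^'n"
    and x\<^sub>c :: "real^'n"
    and \<sigma> :: "nat \<Rightarrow> real" and k :: nat
    and c\<^sub>1 c\<^sub>2 \<Gamma>\<^sub>1 \<Gamma>\<^sub>2 :: real
  assumes F_C1: "continuously_differentiable F"
    and sigma: "\<And>i. 0 \<le> \<sigma> i"
    and c: "0 < c\<^sub>1" "c\<^sub>1 \<le> c\<^sub>2"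
    and Gamma1: "0 < \<Gamma>\<^sub>1" "\<Gamma>\<^sub>1 \<le> c\<^sub>1 / (2 * c\<^sub>2\<^sup>2)"
    and Gamma2: "0 < \<Gamma>\<^sub>2" "1 / c\<^sub>1 \<le> \<Gamma>\<^sub>2"
    and theta_lt: "theta F x\<^sub>c < - \<sigma> k"
    and B_spd: "\<And>j. symmetric_positive_definite (B j x\<^sub>c)"
    and B_eig: "\<And>j. c\<^sub>1 \<le> lambda_min (B j x\<^sub>c) \<and> lambda_min (B j x\<^sub>c) \<le> lambda_max (B j x\<^sub>c)
                     \<and> lambda_max (B j x\<^sub>c) \<le> c\<^sub>2"
    and newton: "v\<^sub>D x\<^sub>c = newton_direction F B x\<^sub>c"
  shows "max_dir_deriv F x\<^sub>c (v\<^sub>D x\<^sub>c) \<le> - \<Gamma>\<^sub>1 * (norm (steepest_direction F x\<^sub>c))\<^sup>2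
       \<and> norm (v\<^sub>D x\<^sub>c) \<le> \<Gamma>\<^sub>2 * norm (steepest_direction F x\<^sub>c)"
proof -
  define v where "v = steepest_direction F x\<^sub>c"
  define w where "w = newton_direction F B x\<^sub>c"
  define D where "D = max_dir_deriv F x\<^sub>c"
  let ?g = "\<lambda>j. grad (\<lambda>y. F y $ j) x\<^sub>c"
  let ?q = "\<lambda>d. MAX j. ?g j \<bullet> d + 1/2 * (d \<bullet> (B j x\<^sub>c *v d))"
  have sym: "transpose (B j x\<^sub>c) = B j x\<^sub>c" for j
    using B_spd by (simp add: symmetric_positive_definite_def)
  have lower: "c\<^sub>1 * (norm d)\<^sup>2 \<le> d \<bullet> (B j x\<^sub>c *v d)" for j d
    using lambda_min_le_form[OF sym, of j d] mult_right_mono[OF conjunct1[OF B_eig], of "d \<bullet> d" j]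
    by (simp add: dot_square_norm)
  have upper: "d \<bullet> (B j x\<^sub>c *v d) \<le> c\<^sub>2 * (norm d)\<^sup>2" for j d
  proof -
    have "lambda_max (B j x\<^sub>c) * (d \<bullet> d) \<le> c\<^sub>2 * (d \<bullet> d)"
      by (rule mult_right_mono) (use B_eig in auto)
    with form_le_lambda_max[OF sym, of d j] show ?thesis by (simp add: dot_square_norm)
  qed
  have min: "?q w \<le> ?q d" for d
    unfolding w_def by (rule newton_direction_minimal) (rule c(1), rule lower)
  have "?g j \<bullet> w \<le> - c\<^sub>1 * (norm w)\<^sup>2" for j
    by (rule MAX_quadratic_minimizer_descent[OF lower _ min])
      (simp add: matrix_vector_mult_scaleR power2_eq_square)
  then have Dw: "D w \<le> - c\<^sub>1 * (norm w)\<^sup>2"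
    by (simp add: D_def max_dir_deriv_le_iff)
  have c2: "0 < c\<^sub>2" using c by linarith
  \<comment> \<open>The quadratic terms are nonnegative, so adding them can only raise the
    maximum.\<close>
  have Dw_q: "D w \<le> ?q w"
    unfolding D_def max_dir_deriv_le_iff
  proof
    fix j
    have "0 \<le> c\<^sub>1 * (norm w)\<^sup>2" using c by simp
    then show "?g j \<bullet> w \<le> ?q w"
      using lower[of w j] MAX_ge[of "\<lambda>j. ?g j \<bullet> w + 1/2 * (w \<bullet> (B j x\<^sub>c *v w))" j] by linarith
  qed
  \<comment> \<open>The factor \<open>1 / c\<^sub>2\<close> is the best one: along
    \<open>s v\<close> with \<open>s \<ge> 0\<close> the bounds give
    \<open>(- s + c\<^sub>2 * s^2 / 2) * (norm v)^2\<close>, which is least at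
    \<open>s = 1 / c\<^sub>2\<close>.\<close>
  have "?g j \<bullet> (v /\<^sub>R c\<^sub>2) + 1/2 * ((v /\<^sub>R c\<^sub>2) \<bullet> (B j x\<^sub>c *v (v /\<^sub>R c\<^sub>2))) \<le> - (norm v)\<^sup>2 / (2 * c\<^sub>2)" for j
  proof -
    have "?g j \<bullet> v \<le> - (norm v)\<^sup>2"
      using max_dir_deriv_ge max_dir_deriv_steepest_le unfolding v_def by (rule order_trans)
    then have "(?g j \<bullet> v) / c\<^sub>2 \<le> - (norm v)\<^sup>2 / c\<^sub>2"
      by (rule divide_right_mono) (use c2 in simp)
    moreover have "(v /\<^sub>R c\<^sub>2) \<bullet> (B j x\<^sub>c *v (v /\<^sub>R c\<^sub>2)) \<le> (norm v)\<^sup>2 / c\<^sub>2"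
      using upper[of "v /\<^sub>R c\<^sub>2" j] c2 by (simp add: power2_eq_square field_simps)
    ultimately show ?thesis by (simp add: field_simps)
  qed
  then have "?q (v /\<^sub>R c\<^sub>2) \<le> - (norm v)\<^sup>2 / (2 * c\<^sub>2)"
    unfolding MAX_le_iff by blast
  with Dw_q min[of "v /\<^sub>R c\<^sub>2"] have "D w \<le> - (norm v)\<^sup>2 / (2 * c\<^sub>2)"
    by linarith
  also have "\<dots> = - (1 / (2 * c\<^sub>2)) * (norm v)\<^sup>2" by simp
  also have "\<dots> \<le> - \<Gamma>\<^sub>1 * (norm v)\<^sup>2"
  proof (rule mult_right_mono)
    have "c\<^sub>1 / (2 * c\<^sub>2\<^sup>2) \<le> 1 / (2 * c\<^sub>2)"
      using c c2 by (simp add: field_simps power2_eq_square)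
    with Gamma1 show "- (1 / (2 * c\<^sub>2)) \<le> - \<Gamma>\<^sub>1" by linarith
  qed simp
  finally have test1: "D w \<le> - \<Gamma>\<^sub>1 * (norm v)\<^sup>2" .
  have "- (v \<bullet> w) \<le> D w"
    unfolding v_def D_def by (rule max_dir_deriv_ge_steepest)
  \<comment> \<open>The chain is \<open>c\<^sub>1 * (norm w)^2 \<le> - D w \<le> v \<bullet> w \<le>
    norm v * norm w\<close>; a factor \<open>norm w\<close> is then cancelled, the case
    \<open>w = 0\<close> being trivial.\<close>
  with Dw norm_cauchy_schwarz[of v w] have "norm w * (c\<^sub>1 * norm w) \<le> norm w * norm v"
    by (simp add: power2_eq_square algebra_simps)
  then have "c\<^sub>1 * norm w \<le> norm v"
    by (cases "w = 0") auto
  then have "norm w \<le> 1 / c\<^sub>1 * norm v"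
    using c by (simp add: field_simps)
  also have "\<dots> \<le> \<Gamma>\<^sub>2 * norm v"
    by (rule mult_right_mono[OF Gamma2(2)]) simp
  finally show ?thesis
    using test1 newton by (simp add: v_def w_def D_def)
qed

end
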